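(* Let $\lambda\in\mathbf R$, $\lambda\ne0$, and let $\mathbf K_{\rm ext}=\mathbf Z^3\setminus\mathbf K_{\rm int}$, where $\mathbf K_{\rm int}$ is a compact convex set of $\mathbf Z^3$. Assume that the Rellich type theorem (RT) for $\hat H^D-\lambda$ holds. Let $\hat u\in\mathcal B_0^*(\mathbf Z^3;\mathbf C^6)$ be a solution of $((\hat H^{D_p}-\lambda)\hat u)(n)=0$ for all $n\in\mathbf K_{\rm ext}$. Then $\hat u$ vanishes in $\mathbf K_{\rm ext}$.
   Context: A compact convex set of $\mathbf Z^3$ is a set of the form $\Omega\cap\mathbf Z^3$ with $\Omega\subset\mathbf R^3$ bounded and convex. Operators: for sequences on $\mathbf Z^3$ let $(\hat y_j\hat u)(n)=\frac1{2i}(\hat u(n+e_j)-\hat u(n-e_j))$ (this is multiplication by $y_j=\sin x_j$ under the Fourier convention $u(x)=(2\pi)^{-3/2}\sum_n e^{-in\cdot x}\hat u(n)$). The isotropic discrete Maxwell operator $\hat H_0$ acts on sequences $\hat u:\mathbf Z^3\to\mathbf C^6$ as the block matrix $\begin{pmatrix}0&\tilde M\\-\tilde M&0\end{pmatrix}$, $\tilde M=\begin{pmatrix}0&-\hat y_3&\hat y_2\\ \hat y_3&0&-\hat y_1\\-\hat y_2&\hat y_1&0\end{pmatrix}$. Let $\epsilon_j,\mu_j\in(0,\infty)$ for $1\le j\le3$, $\hat D=\mathrm{diag}(\epsilon_1,\epsilon_2,\epsilon_3,\mu_1,\mu_2,\mu_3)$ and $\hat H^D=\hat D\hat H_0$.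 The perturbed operator is $\hat H^{D_p}=\hat D_p\hat H_0$, where $\hat D_p$ is multiplication by the real diagonal matrix $\hat D_p(n)=\mathrm{diag}(\tilde\epsilon_1(n),\tilde\epsilon_2(n),\tilde\epsilon_3(n),\tilde\mu_1(n),\tilde\mu_2(n),\tilde\mu_3(n))$ with $\tilde\epsilon_j(n)>0,\tilde\mu_j(n)>0$ for all $j$ and $n\in\mathbf Z^3$, and $\hat D_p(n)=\hat D$ for all but finitely many $n$. For $n\in\mathbf Z^3$, $|n|=\sum_j|n_j|$. $\mathcal B_0^*(\mathbf Z^3;\mathbf C^6)=\{\hat u:\mathbf Z^3\to\mathbf C^6:\ \lim_{R\to\infty}\frac1R\sum_{|n|<R}|\hat u(n)|^2=0\}$. (RT) for $\hat H^D-\lambda$ holds means: whenever $\hat u\in\mathcal B_0^*(\mathbf Z^3;\mathbf C^6)$ satisfies $((\hat H^D-\lambda)\hat u)(n)=0$ for all $n$ outside a compact (finite) subset of $\mathbf Z^3$, there is $R>0$ such that $\hat u(n)=0$ for all $|n|>R$. *)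

theory Defs
  imports "HOL-Analysis.Analysis"
begin

type_synonym lattice = "int ^ 3"

definition l1norm :: "lattice \<Rightarrow> int" where
  "l1norm n = (\<Sum>j\<in>UNIV. \<bar>n $ j\<bar>)"

definition compact_convex_lattice :: "lattice set \<Rightarrow> bool" where
  "compact_convex_lattice K \<longleftrightarrow>
     (\<exists>\<Omega> :: (real ^ 3) set. bounded \<Omega> \<and> convex \<Omega> \<and> K = {n. (\<chi> j. real_of_int (n $ j)) \<in> \<Omega>})"

text \<open>Under the Fourier convention \<open>u(x) = (2 pi)^(-3/2) * sum_n e^(-i n.x) u(n)\<close> this is
  multiplication by \<open>y_j = sin x_j\<close>.\<close>

definition yhat :: "3 \<Rightarrow> (lattice \<Rightarrow> complex) \<Rightarrow> lattice \<Rightarrow> complex" where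
  "yhat j f n = 1 / (2 * \<i>) * (f (n + axis j 1) - f (n - axis j 1))"

definition Mtilde :: "(lattice \<Rightarrow> complex ^ 3) \<Rightarrow> lattice \<Rightarrow> complex ^ 3" where
  "Mtilde v n = vector
     [ - yhat 3 (\<lambda>m. v m $ 2) n + yhat 2 (\<lambda>m. v m $ 3) n,
         yhat 3 (\<lambda>m. v m $ 1) n - yhat 1 (\<lambda>m. v m $ 3) n,
       - yhat 2 (\<lambda>m. v m $ 1) n + yhat 1 (\<lambda>m. v m $ 2) n ]"

text \<open>In the index type \<open>6\<close> the numeral \<open>6\<close> denotes the class of 0; it is the sixth component
  of \<open>vector\<close>, see lemma \<open>vector_6\<close> below.\<close>

definition upper3 :: "'a ^ 6 \<Rightarrow> 'a::zero ^ 3" where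
  "upper3 w = vector [w $ 1, w $ 2, w $ 3]"

definition lower3 :: "'a ^ 6 \<Rightarrow> 'a::zero ^ 3" where
  "lower3 w = vector [w $ 4, w $ 5, w $ 6]"

definition join3 :: "'a ^ 3 \<Rightarrow> 'a ^ 3 \<Rightarrow> 'a::zero ^ 6" where
  "join3 a b = vector [a $ 1, a $ 2, a $ 3, b $ 1, b $ 2, b $ 3]"

definition H0 :: "(lattice \<Rightarrow> complex ^ 6) \<Rightarrow> lattice \<Rightarrow> complex ^ 6" where
  "H0 u n = join3 (Mtilde (\<lambda>m. lower3 (u m)) n) (- Mtilde (\<lambda>m. upper3 (u m)) n)"

text \<open>A real diagonal matrix is represented by the vector of its diagonal entries.\<close>

definition diag_mult :: "real ^ 6 \<Rightarrow> complex ^ 6 \<Rightarrow> complex ^ 6" where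
  "diag_mult d w = (\<chi> i. complex_of_real (d $ i) * w $ i)"

definition Dhat :: "real ^ 3 \<Rightarrow> real ^ 3 \<Rightarrow> real ^ 6" where
  "Dhat \<epsilon> \<mu> = join3 \<epsilon> \<mu>"

definition HD :: "real ^ 6 \<Rightarrow> (lattice \<Rightarrow> complex ^ 6) \<Rightarrow> lattice \<Rightarrow> complex ^ 6" where
  "HD d u n = diag_mult d (H0 u n)"

definition HDp :: "(lattice \<Rightarrow> real ^ 6) \<Rightarrow> (lattice \<Rightarrow> complex ^ 6) \<Rightarrow> lattice \<Rightarrow> complex ^ 6" where
  "HDp dp u n = diag_mult (dp n) (H0 u n)"

definition B0star :: "(lattice \<Rightarrow> complex ^ 6) set" where
  "B0star = {u. ((\<lambda>R::real. 1 / R * (\<Sum>n | real_of_int (l1norm n) < R. (norm (u n))\<^sup>2)) \<longlongrightarrow> 0) at_top}"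

definition RT :: "real ^ 6 \<Rightarrow> real \<Rightarrow> bool" where
  "RT d lam \<longleftrightarrow>
     (\<forall>u\<in>B0star. (\<exists>F. finite F \<and> (\<forall>n. n \<notin> F \<longrightarrow> HD d u n - lam *\<^sub>R u n = 0)) \<longrightarrow>
        (\<exists>R::real. R > 0 \<and> (\<forall>n. real_of_int (l1norm n) > R \<longrightarrow> u n = 0)))"

lemma vector_6 [simp]:
  fixes a b c d e f :: "'a::zero"
  shows "(vector [a, b, c, d, e, f] :: 'a ^ 6) $ 1 = a"
    "(vector [a, b, c, d, e, f] :: 'a ^ 6) $ 2 = b"
    "(vector [a, b, c, d, e, f] :: 'a ^ 6) $ 3 = c"
    "(vector [a, b, c, d, e, f] :: 'a ^ 6) $ 4 = d"
    "(vector [a, b, c, d, e, f] :: 'a ^ 6) $ 5 = e"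
    "(vector [a, b, c, d, e, f] :: 'a ^ 6) $ 6 = f"
  unfolding vector_def by auto

lemma exhaust_6:
  fixes x :: 6
  shows "x = 1 \<or> x = 2 \<or> x = 3 \<or> x = 4 \<or> x = 5 \<or> x = 6"
proof (induct x)
  case (of_int z)
  then have "z = 0 \<or> z = 1 \<or> z = 2 \<or> z = 3 \<or> z = 4 \<or> z = 5" by auto
  then show ?case by auto
qed

lemma finite_l1norm_less: "finite {n. real_of_int (l1norm n) < R}"
proof -
  have "{n. real_of_int (l1norm n) < R} \<subseteq> (\<lambda>f. \<chi> j. f j) ` (UNIV \<rightarrow>\<^sub>E {-\<lceil>R\<rceil>..\<lceil>R\<rceil>})"
  proof
    fix n assume "n \<in> {n. real_of_int (l1norm n) < R}"
    then have *: "l1norm n \<le> \<lceil>R\<rceil>" by (simp add: less_ceiling_iff less_imp_le)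
    have "\<bar>n $ j\<bar> \<le> l1norm n" for j
      unfolding l1norm_def by (rule member_le_sum) auto
    then have "\<bar>n $ j\<bar> \<le> \<lceil>R\<rceil>" for j using * order_trans by blast
    then have "($) n \<in> UNIV \<rightarrow>\<^sub>E {-\<lceil>R\<rceil>..\<lceil>R\<rceil>}"
      by (auto simp: PiE_def abs_le_iff minus_le_iff)
    then show "n \<in> (\<lambda>f. \<chi> j. f j) ` (UNIV \<rightarrow>\<^sub>E {-\<lceil>R\<rceil>..\<lceil>R\<rceil>})"
      by (intro image_eqI[of _ _ "($) n"]) auto
  qed
  then show ?thesis
    by (rule finite_subset) (intro finite_imageI finite_PiE; simp)
qed

end

theory Submission
  imports Defs
begin

text \<open>By the Rellich type theorem \<open>u\<close> has finite support. A point \<open>n\<^sub>0\<close> outside the convex set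
  is strictly separated from it by a linear functional \<open>\<theta>\<close>, which may be perturbed so that
  \<open>\<bar>\<theta>\<^sub>k\<bar>\<close> is the unique largest coefficient. Let \<open>n\<^sub>1\<close> maximise \<open>\<theta>\<close> on the support of \<open>u\<close>, and step
  from \<open>n\<^sub>1\<close> to the neighbour \<open>m\<close> in the direction \<open>\<plusminus>e\<^sub>k\<close> along which \<open>\<theta>\<close> grows. Among \<open>m\<close> and its
  neighbours only \<open>n\<^sub>1\<close> can carry a nonzero value, so the curl equations at \<open>m\<close> annihilate the
  components of both fields at \<open>n\<^sub>1\<close> transversal to \<open>e\<^sub>k\<close>. Since \<open>\<lambda> \<noteq> 0\<close>, the fields divided by their
  coefficients are discrete curls, hence divergence free, and the divergence equation at \<open>m\<close>
  annihilates the component along \<open>e\<^sub>k\<close>.\<close>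

text \<open>\<open>Mtilde\<close> is the curl with \<open>yhat j\<close> in place of the j-th
  partial derivative. These difference operators commute, so div curl = 0 carries over.\<close>

lemma yhat_divergence_Mtilde: "(\<Sum>j\<in>UNIV. yhat j (\<lambda>p. Mtilde v p $ j) m) = 0"
  by (simp add: sum_3 yhat_def Mtilde_def algebra_simps add_divide_distrib diff_divide_distrib)

lemma axis_uminus: "axis k (- x) = - (axis k x :: 'a::ab_group_add ^ 'n)"
  by (simp add: vec_eq_iff axis_def)

text \<open>The central difference at \<open>n + axis k s\<close> sees only \<open>n\<close> and the
  point two steps further, so \<open>f n\<close> alone survives.\<close>

lemma yhat_eq_0_iff:
  assumes s: "s = 1 \<or> s = (-1::int)" and "f (n + axis k s + axis k s) = 0"
  shows "yhat k f (n + axis k s) = 0 \<longleftrightarrow> f n = 0"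
  using assms by (auto simp: yhat_def axis_uminus)

text \<open>When only differences along \<open>k\<close> survive, each row of the curl other than
  row \<open>k\<close> is, up to sign, \<open>yhat k\<close> of one transversal component.\<close>

lemma Mtilde_transversal:
  assumes "Mtilde v m = 0" and other: "\<And>i j. j \<noteq> k \<Longrightarrow> yhat j (\<lambda>p. v p $ i) m = 0"
    and "i \<noteq> k"
  shows "yhat k (\<lambda>p. v p $ i) m = 0"
proof -
  have "Mtilde v m $ 1 = 0" "Mtilde v m $ 2 = 0" "Mtilde v m $ 3 = 0"
    using assms(1) by simp_all
  moreover have "k = 1 \<or> k = 2 \<or> k = 3" "i = 1 \<or> i = 2 \<or> i = 3"
    by (rule exhaust_3)+
  ultimately show ?thesis
    using \<open>i \<noteq> k\<close> by (auto simp: Mtilde_def other)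
qed

text \<open>Stated for a single curl equation so that it serves both Maxwell equations, with the two
  fields exchanged. Each use handles the transversal part of \<open>v\<close> and the longitudinal
  part of \<open>w\<close>; two uses cover all six components.\<close>

lemma curl_extremal_point:
  fixes v w :: "lattice \<Rightarrow> complex ^ 3" and n :: lattice and k :: 3 and s :: int
  defines "m \<equiv> n + axis k s"
  assumes s: "s = 1 \<or> s = (-1::int)"
    and curl: "\<And>p j. p \<in> P \<Longrightarrow> Mtilde v p $ j = a p j * w p $ j"
    and a: "\<And>p j. a p j \<noteq> 0"
    and P: "m \<in> P" "\<And>j. m + axis j 1 \<in> P" "\<And>j. m - axis j 1 \<in> P"
    and zero: "\<And>p. p \<in> P \<Longrightarrow> p \<noteq> n \<Longrightarrow> v p = 0 \<and> w p = 0"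
  shows "w n $ k = 0" and "i \<noteq> k \<Longrightarrow> v n $ i = 0"
proof -
  have m: "m = n + axis k 1 \<or> m = n - axis k 1"
    using s by (auto simp: m_def axis_uminus)
  have ne: "m + axis k s \<noteq> n" "m \<noteq> n"
    using s by (auto simp: m_def vec_eq_iff axis_def)
  have ne': "m + axis j 1 \<noteq> n" "m - axis j 1 \<noteq> n" if "j \<noteq> k" for j
  proof -
    have "(m + axis j 1) $ j \<noteq> n $ j" "(m - axis j 1) $ j \<noteq> n $ j"
      using that by (auto simp: m_def axis_def)
    then show "m + axis j 1 \<noteq> n" "m - axis j 1 \<noteq> n" by auto
  qed
  have mP: "m + axis k s \<in> P" using s P(2,3)[of k] by (auto simp: axis_uminus)
  have nP: "n \<in> P" using m P(2,3)[of k] by auto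
  have other: "yhat j f m = 0" if "j \<noteq> k" "\<And>p. p \<in> P \<Longrightarrow> p \<noteq> n \<Longrightarrow> f p = 0" for f j
    using that ne'[OF that(1)] P(2,3)[of j] by (simp add: yhat_def)
  have main: "f n = 0" if "yhat k f m = 0" "\<And>p. p \<in> P \<Longrightarrow> p \<noteq> n \<Longrightarrow> f p = 0" for f
    using that yhat_eq_0_iff[OF s, of f n k] ne mP by (simp add: m_def)
  show "v n $ i = 0" if "i \<noteq> k"
  proof (rule main)
    have "Mtilde v m = 0"
      using curl[OF P(1)] zero[OF P(1)] ne by (simp add: vec_eq_iff)
    then show "yhat k (\<lambda>p. v p $ i) m = 0"
      by (rule Mtilde_transversal) (use that zero in \<open>auto intro!: other\<close>)
  qed (use zero in simp)
  \<comment> \<open>The stencil of the curl at \<open>p\<close> may leave \<open>P\<close>, so this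
    is read off from the equation and \<open>w p = 0\<close>, not from the values of
    \<open>v\<close>.\<close>
  have g: "Mtilde v p $ j = 0" if "p \<in> P" "p \<noteq> n" for p j
    using curl[OF that(1)] zero[OF that] by simp
  have "(\<Sum>j\<in>UNIV. yhat j (\<lambda>p. Mtilde v p $ j) m) = yhat k (\<lambda>p. Mtilde v p $ k) m"
    by (subst sum.remove[of _ k]) (auto intro!: sum.neutral other g)
  then have "yhat k (\<lambda>p. Mtilde v p $ k) m = 0"
    by (simp add: yhat_divergence_Mtilde)
  then have "Mtilde v n $ k = 0"
    using g by (rule main)
  then show "w n $ k = 0"
    using curl[OF nP] a by simp
qed

abbreviation real_vec :: "lattice \<Rightarrow> real ^ 3" where
  "real_vec n \<equiv> (\<chi> j. real_of_int (n $ j))"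

lemma compact_convex_lattice_finite:
  assumes "compact_convex_lattice K"
  shows "finite K"
proof -
  obtain \<Omega> where \<Omega>: "bounded \<Omega>" "K = {n. real_vec n \<in> \<Omega>}"
    using assms by (auto simp: compact_convex_lattice_def)
  obtain B where B: "\<And>x. x \<in> \<Omega> \<Longrightarrow> norm x \<le> B"
    using \<Omega>(1) by (auto simp: bounded_iff)
  \<comment> \<open>Each of the three coordinates contributes at most \<open>B\<close>; the extra 1
    makes the bound strict.\<close>
  have "real_of_int (l1norm n) < 3 * B + 1" if "n \<in> K" for n
  proof -
    have "norm (real_vec n) \<le> B" using that B \<Omega>(2) by auto
    then have "\<bar>real_of_int (n $ j)\<bar> \<le> B" for j
      using component_le_norm_cart[of "real_vec n" j] by simp
    from this[of 1] this[of 2] this[of 3] show ?thesis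
      by (simp add: l1norm_def sum_3)
  qed
  then show ?thesis
    by (intro finite_subset[OF _ finite_l1norm_less[of "3 * B + 1"]]) auto
qed

text \<open>\<open>\<Omega>\<close> may fail to be closed, so the hyperplane is taken for the convex
  hull of the finite set \<open>K\<close>, which is compact and stays inside
  \<open>\<Omega>\<close>.\<close>

lemma compact_convex_lattice_separation:
  assumes K: "compact_convex_lattice K" and "n\<^sub>0 \<notin> K"
  obtains \<theta> :: "real ^ 3"
  where "\<And>x. x \<in> K \<Longrightarrow> \<theta> \<bullet> real_vec x < \<theta> \<bullet> real_vec n\<^sub>0"
proof -
  obtain \<Omega> where \<Omega>: "convex \<Omega>" "K = {n. real_vec n \<in> \<Omega>}"
    using K by (auto simp: compact_convex_lattice_def)
  let ?C = "convex hull (real_vec ` K)"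
  have "?C \<subseteq> \<Omega>" using \<Omega> by (intro hull_minimal) auto
  then have "real_vec n\<^sub>0 \<notin> ?C" using \<Omega>(2) \<open>n\<^sub>0 \<notin> K\<close> by auto
  moreover have "closed ?C"
    using compact_convex_lattice_finite[OF K]
    by (intro compact_imp_closed finite_imp_compact_convex_hull finite_imageI)
  ultimately obtain a b where ab: "a \<bullet> real_vec n\<^sub>0 < b" "\<And>x. x \<in> ?C \<Longrightarrow> a \<bullet> x > b"
    using separating_hyperplane_closed_point[of ?C "real_vec n\<^sub>0"] by auto
  have "(- a) \<bullet> real_vec x < (- a) \<bullet> real_vec n\<^sub>0" if "x \<in> K" for x
  proof -
    have "real_vec x \<in> ?C" using that by (intro hull_inc) auto
    with ab show ?thesis by fastforce
  qed
  then show ?thesis by (rule that)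
qed

text \<open>Finitely many strict inequalities survive a small perturbation, so a largest coefficient
  can be made strictly dominant.\<close>

lemma dominant_separation:
  assumes K: "compact_convex_lattice K" and "n\<^sub>0 \<notin> K"
  obtains \<theta> :: "real ^ 3" and k and s :: int
  where "\<And>x. x \<in> K \<Longrightarrow> \<theta> \<bullet> real_vec x < \<theta> \<bullet> real_vec n\<^sub>0" and "s = 1 \<or> s = -1"
    and "\<And>j. j \<noteq> k \<Longrightarrow> \<bar>\<theta> $ j\<bar> < s * \<theta> $ k" and "s * \<theta> $ k > 0"
proof -
  obtain \<theta> :: "real ^ 3" where \<theta>: "\<And>x. x \<in> K \<Longrightarrow> \<theta> \<bullet> real_vec x < \<theta> \<bullet> real_vec n\<^sub>0"
    using compact_convex_lattice_separation[OF assms] by blast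
  have "Max (range (\<lambda>j. \<bar>\<theta> $ j\<bar>)) \<in> range (\<lambda>j. \<bar>\<theta> $ j\<bar>)"
    by (intro Max_in) auto
  then obtain k where "Max (range (\<lambda>j. \<bar>\<theta> $ j\<bar>)) = \<bar>\<theta> $ k\<bar>"
    by (rule imageE)
  then have k: "\<bar>\<theta> $ j\<bar> \<le> \<bar>\<theta> $ k\<bar>" for j
    by (metis Max_ge finite finite_imageI rangeI)
  define s :: int where "s = (if \<theta> $ k \<ge> 0 then 1 else -1)"
  have s: "s = 1 \<or> s = -1" and sk: "s * \<theta> $ k = \<bar>\<theta> $ k\<bar>"
    by (auto simp: s_def)
  \<comment> \<open>This enlarges the absolute value of coefficient \<open>k\<close> by
    \<open>t\<close> and leaves the others alone. It breaks ties and also covers a zero functional,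
    possible when \<open>K\<close> is empty.\<close>
  define \<theta>' where "\<theta>' t = \<theta> + t *\<^sub>R axis k (real_of_int s)" for t
  have "\<forall>\<^sub>F t in at_right 0. \<theta>' t \<bullet> real_vec x < \<theta>' t \<bullet> real_vec n\<^sub>0" if "x \<in> K" for x
  proof -
    have "((\<lambda>t. \<theta>' t \<bullet> real_vec n\<^sub>0 - \<theta>' t \<bullet> real_vec x) \<longlongrightarrow>
        \<theta>' 0 \<bullet> real_vec n\<^sub>0 - \<theta>' 0 \<bullet> real_vec x) (at_right 0)"
      unfolding \<theta>'_def by (intro tendsto_intros)
    moreover have "\<theta>' 0 \<bullet> real_vec n\<^sub>0 - \<theta>' 0 \<bullet> real_vec x > 0"
      using \<theta>[OF that] by (simp add: \<theta>'_def)
    ultimately have "\<forall>\<^sub>F t in at_right 0. \<theta>' t \<bullet> real_vec n\<^sub>0 - \<theta>' t \<bullet> real_vec x > 0"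
      by (rule order_tendstoD(1))
    then show ?thesis by (rule eventually_mono) simp
  qed
  then have "\<forall>\<^sub>F t in at_right 0. \<forall>x\<in>K. \<theta>' t \<bullet> real_vec x < \<theta>' t \<bullet> real_vec n\<^sub>0"
    using compact_convex_lattice_finite[OF K] by (simp add: eventually_ball_finite)
  moreover have "\<forall>\<^sub>F t in at_right (0::real). t > 0"
    by (simp add: eventually_at_right_less)
  ultimately have "\<forall>\<^sub>F t in at_right 0. t > 0 \<and> (\<forall>x\<in>K. \<theta>' t \<bullet> real_vec x < \<theta>' t \<bullet> real_vec n\<^sub>0)"
    by eventually_elim simp
  then obtain t where t: "t > 0" "\<And>x. x \<in> K \<Longrightarrow> \<theta>' t \<bullet> real_vec x < \<theta>' t \<bullet> real_vec n\<^sub>0"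
    using eventually_happens'[OF trivial_limit_at_right_real] by blast
  have sk': "s * \<theta>' t $ k = \<bar>\<theta> $ k\<bar> + t"
  proof -
    have "s * (t * s) = t" using s by auto
    then show ?thesis
      using sk by (simp add: \<theta>'_def distrib_left)
  qed
  show ?thesis
  proof (rule that[of "\<theta>' t" s k])
    fix j assume "j \<noteq> k"
    then have "\<theta>' t $ j = \<theta> $ j" by (simp add: \<theta>'_def axis_def)
    then show "\<bar>\<theta>' t $ j\<bar> < s * \<theta>' t $ k"
      using k[of j] t(1) by (simp add: sk')
  qed (use t s sk' in auto)
qed

theorem corollary1p5:
  fixes lam :: real
    and \<epsilon> \<mu> :: "real ^ 3"
    and \<epsilon>p \<mu>p :: "lattice \<Rightarrow> real ^ 3"
    and K_int K_ext :: "lattice set"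
    and u :: "lattice \<Rightarrow> complex ^ 6"
  assumes "\<And>j. \<epsilon> $ j > 0" and "\<And>j. \<mu> $ j > 0"
    and "\<And>n j. \<epsilon>p n $ j > 0" and "\<And>n j. \<mu>p n $ j > 0"
    and "finite {n. Dhat (\<epsilon>p n) (\<mu>p n) \<noteq> Dhat \<epsilon> \<mu>}"
    and "lam \<noteq> 0"
    and "compact_convex_lattice K_int"
    and "K_ext = UNIV - K_int"
    and "RT (Dhat \<epsilon> \<mu>) lam"
    and "u \<in> B0star"
    and "\<And>n. n \<in> K_ext \<Longrightarrow> HDp (\<lambda>m. Dhat (\<epsilon>p m) (\<mu>p m)) u n - lam *\<^sub>R u n = 0"
  shows "\<forall>n\<in>K_ext. u n = 0"
proof (rule ccontr)
  assume "\<not> ?thesis"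
  then obtain n\<^sub>0 where n\<^sub>0: "n\<^sub>0 \<notin> K_int" "u n\<^sub>0 \<noteq> 0"
    using assms(8) by auto
  \<comment> \<open>Outside this finite set the perturbed and unperturbed equations
    coincide.\<close>
  let ?F = "K_int \<union> {n. Dhat (\<epsilon>p n) (\<mu>p n) \<noteq> Dhat \<epsilon> \<mu>}"
  have "finite ?F"
    using assms(5) compact_convex_lattice_finite[OF assms(7)] by simp
  moreover have "HD (Dhat \<epsilon> \<mu>) u n - lam *\<^sub>R u n = 0" if "n \<notin> ?F" for n
    using assms(11)[of n] assms(8) that by (simp add: HD_def HDp_def)
  ultimately have "\<exists>F. finite F \<and> (\<forall>n. n \<notin> F \<longrightarrow> HD (Dhat \<epsilon> \<mu>) u n - lam *\<^sub>R u n = 0)"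
    by (intro exI[of _ ?F]) simp
  then have "\<exists>R::real. R > 0 \<and> (\<forall>n. real_of_int (l1norm n) > R \<longrightarrow> u n = 0)"
    using assms(9,10) by (simp add: RT_def)
  then obtain R :: real where R: "\<And>n. real_of_int (l1norm n) > R \<Longrightarrow> u n = 0"
    by auto
  have "{n. u n \<noteq> 0} \<subseteq> {n. real_of_int (l1norm n) < R + 1}"
  proof clarify
    fix n assume "u n \<noteq> 0"
    then show "real_of_int (l1norm n) < R + 1"
      using R[of n] by linarith
  qed
  then have fin: "finite {n. u n \<noteq> 0}"
    by (rule finite_subset) (rule finite_l1norm_less)
  obtain \<theta> :: "real ^ 3" and k and s :: int
    where sep: "\<And>x. x \<in> K_int \<Longrightarrow> \<theta> \<bullet> real_vec x < \<theta> \<bullet> real_vec n\<^sub>0" and s: "s = 1 \<or> s = -1"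
      and dom: "\<And>j. j \<noteq> k \<Longrightarrow> \<bar>\<theta> $ j\<bar> < s * \<theta> $ k" and pos: "s * \<theta> $ k > 0"
    by (rule dominant_separation[OF assms(7) n\<^sub>0(1)]) (rule that)
  define h where "h n = \<theta> \<bullet> real_vec n" for n
  have h_add: "h (x + axis j 1) = h x + \<theta> $ j" "h (x - axis j 1) = h x - \<theta> $ j" for x j
  proof -
    have "real_vec (x + axis j 1) = real_vec x + axis j 1"
      "real_vec (x - axis j 1) = real_vec x - axis j 1"
      by (auto simp: vec_eq_iff axis_def)
    then show "h (x + axis j 1) = h x + \<theta> $ j" "h (x - axis j 1) = h x - \<theta> $ j"
      by (simp_all add: h_def inner_add_right inner_diff_right inner_axis)
  qed
  have ext: "n \<in> K_ext" if "h n \<ge> h n\<^sub>0" for n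
    using sep[of n] that assms(8) by (auto simp: h_def)
  have "Max (h ` {n. u n \<noteq> 0}) \<in> h ` {n. u n \<noteq> 0}"
    using fin n\<^sub>0 by (intro Max_in) auto
  then obtain n where "u n \<noteq> 0" "h n = Max (h ` {n. u n \<noteq> 0})"
    by auto
  with fin have n: "u n \<noteq> 0" "\<And>p. u p \<noteq> 0 \<Longrightarrow> h p \<le> h n"
    by simp_all
  define E H where "E = (\<lambda>p. upper3 (u p))" and "H = (\<lambda>p. lower3 (u p))"
  define m where "m = n + axis k s"
  define P where "P = {m} \<union> range (\<lambda>j. m + axis j 1) \<union> range (\<lambda>j. m - axis j 1)"
  have h_m: "h m = h n + s * \<theta> $ k"
    using s by (auto simp: m_def axis_uminus h_add)
  \<comment> \<open>Relative to \<open>h n\<close>, the neighbours of \<open>m\<close> have height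
    \<open>s * \<theta> $ k\<close> plus or minus \<open>\<theta> $ j\<close>. Dominance makes this
    positive for \<open>j \<noteq> k\<close>; for \<open>j = k\<close> it is 0, at \<open>n\<close>
    itself, or \<open>2 * s * \<theta> $ k\<close>.\<close>
  have h_P: "h p \<ge> h n \<and> (p \<noteq> n \<longrightarrow> h p > h n)" if "p \<in> P" for p
  proof -
    from that consider "p = m" | j where "p = m + axis j 1" | j where "p = m - axis j 1"
      by (auto simp: P_def)
    then show ?thesis
    proof cases
      case 1 then show ?thesis using pos h_m by simp
    next
      case (2 j) then show ?thesis
        using pos h_m dom[of j] s by (cases "j = k") (auto simp: h_add m_def axis_uminus)
    next
      case (3 j) then show ?thesis
        using pos h_m dom[of j] s by (cases "j = k") (auto simp: h_add m_def axis_uminus)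
    qed
  qed
  \<comment> \<open>Since \<open>n\<^sub>0\<close> lies in the support,
    \<open>h p \<ge> h n \<ge> h n\<^sub>0\<close>, and the separation keeps the whole stencil away
    from \<open>K_int\<close>.\<close>
  have P_ext: "p \<in> K_ext" if "p \<in> P" for p
    using h_P[OF that] n(2)[OF n\<^sub>0(2)] by (intro ext) simp
  have zero: "E p = 0 \<and> H p = 0" if "p \<in> P" "p \<noteq> n" for p
  proof -
    have "u p = 0" using h_P[OF that(1)] that(2) n(2)[of p] by force
    then show ?thesis by (simp add: E_def H_def upper3_def lower3_def vec_eq_iff forall_3)
  qed
  have eq: "complex_of_real (Dhat (\<epsilon>p p) (\<mu>p p) $ i) * H0 u p $ i = lam * u p $ i"
    if "p \<in> P" for p i
  proof -
    have "(HDp (\<lambda>m. Dhat (\<epsilon>p m) (\<mu>p m)) u p - lam *\<^sub>R u p) $ i = 0"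
      using assms(11)[OF P_ext[OF that]] by simp
    then show ?thesis
      by (simp add: HDp_def diag_mult_def) (simp add: scaleR_conv_of_real)
  qed
  have curl_H: "Mtilde H p $ j = (lam / \<epsilon>p p $ j) * E p $ j" if "p \<in> P" for p j
    using eq[OF that, of 1] eq[OF that, of 2] eq[OF that, of 3] exhaust_3[of j]
      assms(3)[of p j]
    by (auto simp: Dhat_def H0_def join3_def E_def H_def upper3_def field_simps)
  have curl_E: "Mtilde E p $ j = (- lam / \<mu>p p $ j) * H p $ j" if "p \<in> P" for p j
    using eq[OF that, of 4] eq[OF that, of 5] eq[OF that, of 6] exhaust_3[of j]
      assms(4)[of p j]
    by (auto simp: Dhat_def H0_def join3_def E_def H_def lower3_def field_simps
        neg_eq_iff_add_eq_0 eq_neg_iff_add_eq_0)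
  have nz: "complex_of_real (lam / \<epsilon>p p $ j) \<noteq> 0" "complex_of_real (- lam / \<mu>p p $ j) \<noteq> 0" for p j
    using assms(3,4)[of p j] assms(6) by auto
  have P: "m \<in> P" "m + axis j 1 \<in> P" "m - axis j 1 \<in> P" for j
    by (auto simp: P_def)
  note step = curl_extremal_point[where P = P and n = n and k = k, OF s, folded m_def, OF _ _ P]
  \<comment> \<open>First use with \<open>v = H\<close> and \<open>w = E\<close>; the second one
    exchanges the fields.\<close>
  have "E n $ k = 0" "\<And>i. i \<noteq> k \<Longrightarrow> H n $ i = 0"
    using step[OF curl_H nz(1)] zero by blast+
  moreover have "H n $ k = 0" "\<And>i. i \<noteq> k \<Longrightarrow> E n $ i = 0"
    using step[OF curl_E nz(2)] zero by blast+
  ultimately have EH: "E n $ i = 0" "H n $ i = 0" for i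
    by (cases "i = k"; simp)+
  have "u n $ i = 0" for i
    using exhaust_6[of i] EH[of 1] EH[of 2] EH[of 3]
    by (auto simp: E_def H_def upper3_def lower3_def)
  then show False
    using n(1) by (simp add: vec_eq_iff)
qed

end
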